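(* Let $f:\operatorname{dom}(f)\subseteq\mathbb{R}^n\to\mathbb{R}$, let $\mathcal{X}=\langle x^0,x^0+d^1,\ldots,x^0+d^m\rangle$ be an ordered set of $m+1$ distinct points such that $\mathcal{X}\cup\mathcal{X}^-$ is contained in $\operatorname{dom}(f)$ and for which $f(x^0),f(x^0\pm d^1),\ldots,f(x^0\pm d^m)$ are all nonzero, and let $k$ be a positive integer. Then $$\nabla^c f^{-k}(\mathcal{X})=-k\,f^{-k-1}(x^0)\,\nabla^c f(\mathcal{X})-E^c_{f^{-k}}(\mathcal{X}),$$ where $E^c_{f^{-k}}(\mathcal{X})=\tfrac12\big(E^s_{f^{-k}}(\mathcal{X})+E^s_{f^{-k}}(\mathcal{X}^-)\big)$ and, for $\mathcal{Z}\in\{\mathcal{X},\mathcal{X}^-\}$, $$E^s_{f^{-k}}(\mathcal{Z})=\frac{1}{(f(x^0))^k}(S(\mathcal{Z})^\top)^\dagger\Big(k\,\delta^s_{\frac1f|f}(\mathcal{Z})-\sum_{i=1}^{k-1}(f(x^0))^{1+i}\,\delta^s_{f^{-1}|f^{-i}}(\mathcal{Z})\Big).$$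
   Context: $A^\dagger$ denotes the Moore--Penrose pseudoinverse of a matrix $A$. For an ordered set $\mathcal{Z}=\langle z^0,z^0+e^1,\ldots,z^0+e^m\rangle$ in $\mathbb{R}^n$ put $S(\mathcal{Z})=[e^1\ \cdots\ e^m]\in\mathbb{R}^{n\times m}$ and $\mathcal{Z}^-=\langle z^0,z^0-e^1,\ldots,z^0-e^m\rangle$ (so $S(\mathcal{Z}^-)=-S(\mathcal{Z})$). The generalized centred simplex gradient of a real-valued function $h$ over $\mathcal{Z}$ is $\nabla^c h(\mathcal{Z})=(S(\mathcal{Z})^\top)^\dagger\delta^c_h(\mathcal{Z})$, where $\delta^c_h(\mathcal{Z})\in\mathbb{R}^m$ has $i$-th entry $\tfrac12\big(h(z^0+e^i)-h(z^0-e^i)\big)$. The product difference vector of functions $u,v$ is $\delta^s_{u|v}(\mathcal{Z})\in\mathbb{R}^m$ with $i$-th entry $\big(u(z^0+e^i)-u(z^0)\big)\big(v(z^0+e^i)-v(z^0)\big)$. Here $f^{-j}$ denotes the pointwise power $1/f^j$ (not a functional inverse). *)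

theory Defs
  imports "HOL-Analysis.Analysis"
begin

text \<open>The four Penrose conditions, over the reals.\<close>

definition is_mp_inverse :: "real^'n^'m \<Rightarrow> real^'m^'n \<Rightarrow> bool" where
  "is_mp_inverse A B \<longleftrightarrow>
     A ** B ** A = A \<and> B ** A ** B = B \<and>
     transpose (A ** B) = A ** B \<and> transpose (B ** A) = B ** A"

definition mp_inverse :: "real^'n^'m \<Rightarrow> real^'m^'n" where
  "mp_inverse A = (THE B. is_mp_inverse A B)"

lemma orthogonal_projection_matrix:
  fixes W :: "(real^'n) set"
  assumes "subspace W"
  obtains P :: "real^'n^'n"
  where "transpose P = P" "\<And>x. P *v x \<in> W" "\<And>w. w \<in> W \<Longrightarrow> P *v w = w"
proof -
  obtain B where B: "B \<subseteq> W" "pairwise orthogonal B" "\<And>x. x \<in> B \<Longrightarrow> norm x = 1"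
    "independent B" "span B = W"
    using orthonormal_basis_subspace[OF assms] by metis
  have fin: "finite B" using B(4) by (rule independent_imp_finite)
  define p where "p = (\<lambda>x::real^'n. \<Sum>b\<in>B. (x \<bullet> b) *\<^sub>R b)"
  have lin: "linear p"
    unfolding p_def
    by (rule linearI)
      (simp_all add: inner_add_left scaleR_add_left sum.distrib scaleR_right.sum)
  have pW: "p x \<in> W" for x
    unfolding p_def using B(1) assms
    by (intro subspace_sum subspace_scale) auto
  have pb: "p b = b" if "b \<in> B" for b
  proof -
    have "(b \<bullet> c) *\<^sub>R c = (if c = b then b else 0)" if "c \<in> B" for c
      using B(2) B(3)[OF \<open>b \<in> B\<close>] that \<open>b \<in> B\<close>
      by (auto simp: pairwise_def orthogonal_def norm_eq_1)
    then have "p b = (\<Sum>c\<in>B. if c = b then b else 0)"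
      unfolding p_def by (intro sum.cong) auto
    then show ?thesis using fin that by simp
  qed
  have fix_W: "p w = w" if "w \<in> W" for w
    using linear_eq_on[OF lin linear_id, of w B] that B(5) pb by auto
  have sym: "p x \<bullet> y = x \<bullet> p y" for x y
    unfolding p_def by (simp add: inner_sum_left inner_sum_right inner_commute mult.commute)
  have mp: "matrix p *v x = p x" for x
    using lin by simp
  have "transpose (matrix p) = matrix p"
  proof -
    have "adjoint p = p" using sym by (intro adjoint_unique) auto
    then show ?thesis
      using matrix_adjoint[OF lin] by simp
  qed
  then show thesis using that[of "matrix p"] mp pW fix_W by simp
qed

lemma ex_is_mp_inverse:
  fixes A :: "real^'n^'m"
  shows "\<exists>B. is_mp_inverse A B"
proof -
  obtain P where P: "transpose P = P" "\<And>x. P *v x \<in> range ((*v) A)"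
    "\<And>w. w \<in> range ((*v) A) \<Longrightarrow> P *v w = w"
    using orthogonal_projection_matrix[of "range ((*v) A)"]
    by (metis subspace_UNIV linear_subspace_image matrix_vector_mul_linear)
  let ?V = "range ((*v) (transpose A))"
  have V: "subspace ?V"
    by (metis subspace_UNIV linear_subspace_image matrix_vector_mul_linear)
  obtain Q where Q: "transpose Q = Q" "\<And>x. Q *v x \<in> ?V" "\<And>w. w \<in> ?V \<Longrightarrow> Q *v w = w"
    using orthogonal_projection_matrix[OF V] by metis
  have PA: "P ** A = A"
    by (simp add: matrix_eq P(3) flip: matrix_vector_mul_assoc)
  have "Q ** transpose A = transpose A"
    by (simp add: matrix_eq Q(3) flip: matrix_vector_mul_assoc)
  then have AQ: "A ** Q = A"
    by (metis Q(1) matrix_transpose_mul transpose_transpose)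
  have "inj_on ((*v) A) ?V"
  proof -
    have "v = 0" if "v \<in> ?V" "A *v v = 0" for v
    proof -
      from that obtain u where u: "v = transpose A *v u" by auto
      have "v \<bullet> v = u \<bullet> (A *v v)"
        using dot_lmul_matrix[of u A v] u by simp
      then show "v = 0" using that by simp
    qed
    then show ?thesis
      using V by (simp add: linear_inj_on_iff_eq_0 matrix_vector_mul_linear)
  qed
  then obtain g where g: "g ` UNIV \<subseteq> ?V" "linear g" "\<forall>v\<in>?V. g (A *v v) = v"
    using linear_exists_left_inverse_on[OF matrix_vector_mul_linear[of A] V] by auto
  define G where "G = matrix g"
  have G: "G *v x = g x" for x
    using g(2) by (simp add: G_def)
  have GAQ: "G ** A ** Q = Q"
    using bspec[OF g(3) Q(2)] by (simp add: matrix_eq G flip: matrix_vector_mul_assoc)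
  have QG: "Q ** G = G"
    using g(1) Q(3) by (auto simp: matrix_eq G simp flip: matrix_vector_mul_assoc)
  have GA: "G ** A = Q"
    by (metis GAQ AQ matrix_mul_assoc)
  have AGP: "A ** G ** P = P"
  proof -
    have "(A ** G ** P) *v y = P *v y" for y
    proof -
      obtain x where x: "P *v y = A *v x" using P(2)[of y] by auto
      have "(A ** G ** P) *v y = (A ** G ** A) *v x"
        by (simp add: x flip: matrix_vector_mul_assoc)
      also have "\<dots> = A *v x"
        by (simp add: GA AQ flip: matrix_mul_assoc)
      finally show ?thesis using x by simp
    qed
    then show ?thesis by (simp add: matrix_eq)
  qed
  have "is_mp_inverse A (G ** P)"
    unfolding is_mp_inverse_def
    by (metis AGP GA P(1) PA Q(1) QG matrix_mul_assoc)
  then show ?thesis ..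
qed

lemma is_mp_inverse_unique:
  assumes "is_mp_inverse A B" "is_mp_inverse A C"
  shows "B = C"
proof -
  have 1: "A ** B ** A = A" "B ** A ** B = B"
    "transpose (A ** B) = A ** B" "transpose (B ** A) = B ** A"
    using assms(1) by (auto simp: is_mp_inverse_def)
  have 2: "A ** C ** A = A" "C ** A ** C = C"
    "transpose (A ** C) = A ** C" "transpose (C ** A) = C ** A"
    using assms(2) by (auto simp: is_mp_inverse_def)
  have "A ** B = A ** C ** (A ** B)" using 2(1) by (simp add: matrix_mul_assoc)
  also have "\<dots> = transpose (A ** B ** (A ** C))"
    using 1(3) 2(3) by (simp add: matrix_transpose_mul)
  also have "\<dots> = A ** C" using 1(1) 2(3) by (simp add: matrix_mul_assoc)
  finally have AB: "A ** B = A ** C" .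
  have "B ** A = B ** A ** (C ** A)" using 2(1) by (metis matrix_mul_assoc)
  also have "\<dots> = transpose (C ** A ** (B ** A))"
    using 1(4) 2(4) by (simp add: matrix_transpose_mul)
  also have "\<dots> = C ** A" using 1(1) 2(4) by (metis matrix_mul_assoc)
  finally have BA: "B ** A = C ** A" .
  show ?thesis using 1(2) 2(2) AB BA by (metis matrix_mul_assoc)
qed

lemma is_mp_inverse_mp_inverse: "is_mp_inverse A (mp_inverse A)"
  unfolding mp_inverse_def
  using ex_is_mp_inverse is_mp_inverse_unique by (metis theI)


text \<open>
  The ordered set \<open>\<langle>z0, z0 + e 1, \<dots>, z0 + e m\<rangle>\<close> is encoded by its base point together with the
  family of directions \<open>e\<close>, whose finite index type \<open>'m\<close> plays the role of \<open>{1..m}\<close>.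
\<close>

type_synonym ('n, 'm) sample_set = "(real^'n) \<times> ('m \<Rightarrow> real^'n)"

fun points :: "('n::finite, 'm::finite) sample_set \<Rightarrow> (real^'n) set" where
  "points (z0, e) = insert z0 (range (\<lambda>i. z0 + e i))"

fun reflect :: "('n::finite, 'm::finite) sample_set \<Rightarrow> ('n, 'm) sample_set" where
  "reflect (z0, e) = (z0, \<lambda>i. - e i)"

fun S_mat :: "('n::finite, 'm::finite) sample_set \<Rightarrow> real^'m^'n" where
  "S_mat (z0, e) = (\<chi> r c. e c $ r)"

fun delta_c :: "(real^'n \<Rightarrow> real) \<Rightarrow> ('n::finite, 'm::finite) sample_set \<Rightarrow> real^'m" where
  "delta_c h (z0, e) = (\<chi> i. (h (z0 + e i) - h (z0 - e i)) / 2)"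

definition centred_simplex_gradient ::
    "(real^'n \<Rightarrow> real) \<Rightarrow> ('n::finite, 'm::finite) sample_set \<Rightarrow> real^'n" where
  "centred_simplex_gradient h Z = mp_inverse (transpose (S_mat Z)) *v delta_c h Z"

fun delta_s_prod ::
    "(real^'n \<Rightarrow> real) \<Rightarrow> (real^'n \<Rightarrow> real) \<Rightarrow> ('n::finite, 'm::finite) sample_set \<Rightarrow> real^'m" where
  "delta_s_prod u v (z0, e) = (\<chi> i. (u (z0 + e i) - u z0) * (v (z0 + e i) - v z0))"

definition neg_power :: "(real^'n \<Rightarrow> real) \<Rightarrow> nat \<Rightarrow> real^'n \<Rightarrow> real" where
  "neg_power f j = (\<lambda>x. 1 / f x ^ j)"

text \<open>The error terms attached to the function \<open>f\<^sup>-\<^sup>k\<close>; they depend on \<open>f\<close> and \<open>k\<close> separately.\<close>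

definition E_s :: "(real^'n \<Rightarrow> real) \<Rightarrow> nat \<Rightarrow> ('n::finite, 'm::finite) sample_set \<Rightarrow> real^'n" where
  "E_s f k Z =
     (1 / f (fst Z) ^ k) *\<^sub>R
       (mp_inverse (transpose (S_mat Z)) *v
          (real k *\<^sub>R delta_s_prod (\<lambda>x. 1 / f x) f Z
           - (\<Sum>i = 1..k - 1.
                f (fst Z) ^ (1 + i) *\<^sub>R delta_s_prod (neg_power f 1) (neg_power f i) Z)))"

definition E_c :: "(real^'n \<Rightarrow> real) \<Rightarrow> nat \<Rightarrow> ('n::finite, 'm::finite) sample_set \<Rightarrow> real^'n" where
  "E_c f k X = (1/2) *\<^sub>R (E_s f k X + E_s f k (reflect X))"

end

theory Submission
  imports Defs
begin

text \<open>
  All the terms of the identity are images under one linear map, the pseudoinverse of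
  \<open>S(X)\<^sup>T\<close>: the pseudoinverse of \<open>S(X\<^sup>-)\<^sup>T = - S(X)\<^sup>T\<close> is its negative, so
  the mean of the two error terms \<open>E\<^sup>s\<close> is the image of half the \<^emph>\<open>difference\<close> of the two residual
  vectors in their definition. On the other side, a centred difference is half the difference of
  the two one-sided differences. Hence it suffices to compare components, and there to treat each
  of the points \<open>x0 + d i\<close> and \<open>x0 - d i\<close> separately.

  With \<open>a\<close> the value at \<open>x0\<close>, \<open>b\<close> the value at such a point and \<open>t = a / b\<close>, the one-sided
  identity, multiplied by \<open>a ^ k\<close>, becomes the geometric sum
  \<open>t ^ k - 1 = k (t - 1) + (t - 1) (\<Sum>i=1..k-1. t ^ i - 1)\<close>; this is lemma
  \<open>inverse_power_difference\<close>.
\<close>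

lemma geometric_sum_remainder:
  fixes t :: real
  shows "t ^ k - 1 = real k * (t - 1) + (\<Sum>i = 1..k - 1. (t - 1) * (t ^ i - 1))"
proof (induction k)
  case (Suc k)
  have "(\<Sum>i = 1..Suc k - 1. (t - 1) * (t ^ i - 1))
      = (\<Sum>i = 1..k - 1. (t - 1) * (t ^ i - 1)) + (t - 1) * (t ^ k - 1)"
    by (cases k) simp_all
  with Suc show ?case
    by (simp add: algebra_simps)
qed simp

text \<open>
  The first-order expansion of the \<open>k\<close>-th negative power around \<open>a\<close> with its exact remainder.
  Substituting \<open>t = a / b\<close> turns each weighted product in the sum into \<open>(t - 1) (t ^ i - 1)\<close>, and the
  product \<open>(1/b - 1/a) (b - a)\<close> corrects the relative increment \<open>(b - a) / a\<close> of the linear term to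
  \<open>(b - a) / b = 1 - t\<close>.
\<close>

lemma inverse_power_difference:
  fixes a b :: real
  assumes "a \<noteq> 0" "b \<noteq> 0"
  shows "1 / b ^ k - 1 / a ^ k =
    - (real k * (1 / a ^ (k + 1))) * (b - a)
    - 1 / a ^ k * (real k * ((1 / b - 1 / a) * (b - a))
        - (\<Sum>i = 1..k - 1. a ^ (1 + i) * ((1 / b ^ 1 - 1 / a ^ 1) * (1 / b ^ i - 1 / a ^ i))))"
proof -
  define t where "t = a / b"
  have product: "a ^ (1 + i) * ((1 / b ^ 1 - 1 / a ^ 1) * (1 / b ^ i - 1 / a ^ i))
      = (t - 1) * (t ^ i - 1)" for i
    using assms by (simp add: t_def power_divide field_simps)
  have increment: "(b - a) / a + (1 / b - 1 / a) * (b - a) = 1 - t"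
    using assms by (simp add: t_def field_simps)
  have "1 / b ^ k - 1 / a ^ k = 1 / a ^ k * (t ^ k - 1)"
    using assms by (simp add: t_def power_divide field_simps)
  also have "\<dots> = 1 / a ^ k * (- (real k * (1 - t)) + (\<Sum>i = 1..k - 1. (t - 1) * (t ^ i - 1)))"
    by (subst geometric_sum_remainder) (simp add: algebra_simps)
  also have "\<dots> = - (real k * (1 / a ^ (k + 1))) * (b - a)
      - 1 / a ^ k * (real k * ((1 / b - 1 / a) * (b - a))
          - (\<Sum>i = 1..k - 1. (t - 1) * (t ^ i - 1)))"
    unfolding increment[symmetric] using assms(1) by (simp add: algebra_simps diff_divide_distrib)
  finally show ?thesis
    unfolding product .
qed

lemma mp_inverse_uminus: "mp_inverse (- A) = - mp_inverse A"
proof -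
  have neg: "(- M) ** N = - (M ** N)" "M ** (- N) = - (M ** N)" "transpose (- M) = - transpose M"
    for M :: "real^'x^'y" and N :: "real^'z^'x"
    by (simp_all add: matrix_matrix_mult_def transpose_def vec_eq_iff sum_negf)
  have "is_mp_inverse (- A) (- mp_inverse A)"
    using is_mp_inverse_mp_inverse[of A] by (simp add: is_mp_inverse_def neg)
  then show ?thesis
    using is_mp_inverse_unique is_mp_inverse_mp_inverse by blast
qed

lemma mp_inverse_transpose_S_mat_reflect:
  "mp_inverse (transpose (S_mat (reflect Z))) = - mp_inverse (transpose (S_mat Z))"
proof -
  have "transpose (S_mat (reflect Z)) = - transpose (S_mat Z)"
    by (cases Z) (simp add: transpose_def vec_eq_iff)
  then show ?thesis
    by (simp add: mp_inverse_uminus)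
qed

text \<open>The vector to which the pseudoinverse is applied in \<open>E_s\<close>, scaling factor included.\<close>

definition residual ::
    "(real^'n \<Rightarrow> real) \<Rightarrow> nat \<Rightarrow> ('n::finite, 'm::finite) sample_set \<Rightarrow> real^'m" where
  "residual f k Z = (1 / f (fst Z) ^ k) *\<^sub>R
     (real k *\<^sub>R delta_s_prod (\<lambda>x. 1 / f x) f Z
      - (\<Sum>i = 1..k - 1.
           f (fst Z) ^ (1 + i) *\<^sub>R delta_s_prod (neg_power f 1) (neg_power f i) Z))"

lemma E_s_residual: "E_s f k Z = mp_inverse (transpose (S_mat Z)) *v residual f k Z"
  by (simp add: E_s_def residual_def matrix_vector_mult_scaleR)

lemma E_c_residual:
  "E_c f k Z = mp_inverse (transpose (S_mat Z)) *v
     ((1/2) *\<^sub>R (residual f k Z - residual f k (reflect Z)))"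
proof -
  have neg: "(- M) *v v = - (M *v v)" for M :: "real^'x^'y" and v
    by (simp add: matrix_vector_mult_def vec_eq_iff sum_negf)
  show ?thesis
    by (simp add: E_c_def E_s_residual mp_inverse_transpose_S_mat_reflect neg
        matrix_vector_mult_scaleR matrix_vector_mult_diff_distrib)
qed

lemma neg_power_difference_residual:
  assumes "f z \<noteq> 0" "f (z + e i) \<noteq> 0"
  shows "neg_power f k (z + e i) - neg_power f k z =
    - (real k * neg_power f (k + 1) z) * (f (z + e i) - f z) - residual f k (z, e) $ i"
  using inverse_power_difference[OF assms, of k]
  by (simp only: neg_power_def residual_def fst_conv delta_s_prod.simps vector_scaleR_component
      vector_minus_component sum_component vec_lambda_beta real_scaleR_def)

theorem corollary4p6:
  fixes D :: "(real^'n) set" and f :: "real^'n \<Rightarrow> real"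
    and x0 :: "real^'n" and d :: "'m::finite \<Rightarrow> real^'n"
    and X :: "('n, 'm) sample_set" and k :: nat
  assumes X: "X = (x0, d)"
    and distinct: "card (points X) = CARD('m) + 1"
    and dom: "points X \<union> points (reflect X) \<subseteq> D"
    and nonzero: "f x0 \<noteq> 0" "\<And>i. f (x0 + d i) \<noteq> 0" "\<And>i. f (x0 - d i) \<noteq> 0"
    and k: "k > 0"
  shows "centred_simplex_gradient (neg_power f k) X =
           - (real k * neg_power f (k + 1) x0) *\<^sub>R centred_simplex_gradient f X - E_c f k X"
proof -
  let ?c = "real k * neg_power f (k + 1) x0"
  have "delta_c (neg_power f k) X = - ?c *\<^sub>R delta_c f X
      - (1/2) *\<^sub>R (residual f k X - residual f k (reflect X))"
  proof (subst vec_eq_iff, intro allI)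
    fix i
    have "neg_power f k (x0 + d i) - neg_power f k x0 =
        - ?c * (f (x0 + d i) - f x0) - residual f k X $ i"
      unfolding X by (rule neg_power_difference_residual) (use nonzero in auto)
    moreover have "neg_power f k (x0 - d i) - neg_power f k x0 =
        - ?c * (f (x0 - d i) - f x0) - residual f k (reflect X) $ i"
      using neg_power_difference_residual[of f x0 "\<lambda>i. - d i" i k] nonzero by (simp add: X)
    ultimately have "neg_power f k (x0 + d i) - neg_power f k (x0 - d i) =
        - ?c * (f (x0 + d i) - f (x0 - d i)) - (residual f k X $ i - residual f k (reflect X) $ i)"
      by (simp add: algebra_simps)
    then show "delta_c (neg_power f k) X $ i = (- ?c *\<^sub>R delta_c f X
        - (1/2) *\<^sub>R (residual f k X - residual f k (reflect X))) $ i"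
      by (simp add: X field_simps)
  qed
  then show ?thesis
    unfolding centred_simplex_gradient_def E_c_residual
    by (simp only: matrix_vector_mult_diff_distrib matrix_vector_mult_scaleR)
qed

end
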